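(* Let $N$ be a finite set, let $\alpha\le\beta$ in $\mathcal{A}_N$, and let $\beta = \nu_1 \cup \nu_2$ with $\nu_1$ and $\nu_2$ such that no edge in the graph $\mathcal{G}_{[\alpha,\beta]}$ connects an element of $\nu_1$ with an element of $\nu_2$. Then $$[\alpha,\beta] = [\alpha, \alpha \vee \nu_1] \mathbin{\dot\vee} [\alpha, \alpha \vee \nu_2] = [\alpha \wedge \nu_1,\nu_1] \mathbin{\dot\vee} [\alpha \wedge \nu_2,\nu_2],$$ where $\dot\vee$ denotes the direct join of intervals (in particular both joins are direct).
   Context: For a finite set $N$, $\mathcal{A}_N$ denotes the set of antichains in $N$: sets $\alpha \subseteq 2^N$ such that no two distinct members of $\alpha$ are in a subset/superset relationship. Order: $\alpha \le \beta$ iff for every $A \in \alpha$ there is $B \in \beta$ with $A \subseteq B$. Join and meet: $\alpha\vee\beta=\max(\alpha\cup\beta)$, $\alpha\wedge\beta=\max\{A\cap B : A\in\alpha,B\in\beta\}$, where $\max$ of a set of sets keeps only the inclusion-maximal sets. Intervals: $[\alpha,\beta]=\{\chi : \alpha\le\chi\le\beta\}$. The graph $\mathcal{G}_{[\alpha,\beta]}$ has as vertices the elements of $\beta$; vertices $A,B\in\beta$ are connected by an edge iff $\{A\cap B\}\not\le\alpha$ (this is applied also for $A=B$, so a vertex $A$ with $\{A\}\not\le\alpha$ is connected to itself and cannot lie in both $\nu_1$ and $\nu_2$). The join of two intervals is $[\alpha_1,\beta_1]\vee[\alpha_2,\beta_2]=\{\chi_1\vee\chi_2 : \chi_1\in[\alpha_1,\beta_1],\chi_2\in[\alpha_2,\beta_2]\}$.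 The join is called direct, and written $[\alpha_1,\beta_1]\mathbin{\dot\vee}[\alpha_2,\beta_2]$, if each of its elements has a unique decomposition $\chi_1\vee\chi_2$ of this form. *)

theory Defs
  imports Main
begin

definition antichains :: "'a set \<Rightarrow> 'a set set set" where
  "antichains N = {\<alpha>. \<alpha> \<subseteq> Pow N \<and> (\<forall>A\<in>\<alpha>. \<forall>B\<in>\<alpha>. A \<subseteq> B \<longrightarrow> A = B)}"

definition max_sets :: "'a set set \<Rightarrow> 'a set set" where
  "max_sets S = {A \<in> S. \<forall>B\<in>S. A \<subseteq> B \<longrightarrow> A = B}"

definition ac_le :: "'a set set \<Rightarrow> 'a set set \<Rightarrow> bool" (infix "\<preceq>" 50) where
  "\<alpha> \<preceq> \<beta> \<longleftrightarrow> (\<forall>A\<in>\<alpha>. \<exists>B\<in>\<beta>. A \<subseteq> B)"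

definition ac_join :: "'a set set \<Rightarrow> 'a set set \<Rightarrow> 'a set set" (infixl "\<curlyvee>" 65) where
  "\<alpha> \<curlyvee> \<beta> = max_sets (\<alpha> \<union> \<beta>)"

definition ac_meet :: "'a set set \<Rightarrow> 'a set set \<Rightarrow> 'a set set" (infixl "\<curlywedge>" 70) where
  "\<alpha> \<curlywedge> \<beta> = max_sets {A \<inter> B | A B. A \<in> \<alpha> \<and> B \<in> \<beta>}"

definition ac_interval :: "'a set \<Rightarrow> 'a set set \<Rightarrow> 'a set set \<Rightarrow> 'a set set set" where
  "ac_interval N \<alpha> \<beta> = {\<chi> \<in> antichains N. \<alpha> \<preceq> \<chi> \<and> \<chi> \<preceq> \<beta>}"

text \<open>
  The edge set of the graph of the interval from \<open>\<alpha>\<close> to \<open>\<beta>\<close>; its vertex set is \<open>\<beta>\<close> itself.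
  Edges are unordered pairs \<open>{A, B}\<close>. The case \<open>A = B\<close> is deliberately allowed, so a
  singleton edge \<open>{A}\<close> is a loop at \<open>A\<close>.
\<close>

definition interval_graph_edges :: "'a set set \<Rightarrow> 'a set set \<Rightarrow> 'a set set set" where
  "interval_graph_edges \<alpha> \<beta> = {{A, B} | A B. A \<in> \<beta> \<and> B \<in> \<beta> \<and> \<not> {A \<inter> B} \<preceq> \<alpha>}"

definition interval_join :: "'a set set set \<Rightarrow> 'a set set set \<Rightarrow> 'a set set set" where
  "interval_join I J = {\<chi>\<^sub>1 \<curlyvee> \<chi>\<^sub>2 | \<chi>\<^sub>1 \<chi>\<^sub>2. \<chi>\<^sub>1 \<in> I \<and> \<chi>\<^sub>2 \<in> J}"

definition direct_join :: "'a set set set \<Rightarrow> 'a set set set \<Rightarrow> bool" where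
  "direct_join I J \<longleftrightarrow>
     (\<forall>\<chi>\<in>interval_join I J. \<exists>!p. p \<in> I \<times> J \<and> \<chi> = fst p \<curlyvee> snd p)"

end

theory Submission
  imports Defs
begin

text \<open>
  Passing from an antichain to its down-set embeds the antichains of \<open>N\<close> into a distributive
  lattice of sets, turning joins into unions and meets into intersections. If
  \<open>q\<^sub>1 \<inter> q\<^sub>2 \<subseteq> p\<^sub>1 \<inter> p\<^sub>2\<close>, then any \<open>x = x\<^sub>1 \<union> x\<^sub>2\<close> with \<open>p\<^sub>i \<subseteq> x\<^sub>i \<subseteq> q\<^sub>i\<close> determines
  \<open>x\<^sub>i = x \<inter> q\<^sub>i\<close>, so the join of the two intervals is direct. The absence of edges between
  \<open>\<nu>\<^sub>1\<close> and \<open>\<nu>\<^sub>2\<close> says precisely that \<open>\<nu>\<^sub>1 \<inter> \<nu>\<^sub>2 \<subseteq> \<alpha>\<close> on down-sets, which yields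
  this condition for both pairs of intervals.
\<close>

definition down :: "'a set set \<Rightarrow> 'a set set" where
  "down \<chi> = {X. \<exists>B\<in>\<chi>. X \<subseteq> B}"

lemma ac_le_iff_down: "\<alpha> \<preceq> \<beta> \<longleftrightarrow> down \<alpha> \<subseteq> down \<beta>"
  unfolding ac_le_def down_def Collect_mono_iff by (meson order_refl order_trans)

lemma down_Un: "down (\<alpha> \<union> \<beta>) = down \<alpha> \<union> down \<beta>"
  unfolding down_def by blast

lemma finite_antichain: "finite N \<Longrightarrow> \<alpha> \<in> antichains N \<Longrightarrow> finite \<alpha>"
  unfolding antichains_def by (metis (no_types, lifting) finite_Pow_iff finite_subset mem_Collect_eq)

lemma antichains_subset: "\<alpha> \<in> antichains N \<Longrightarrow> \<nu> \<subseteq> \<alpha> \<Longrightarrow> \<nu> \<in> antichains N"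
  unfolding antichains_def mem_Collect_eq by (meson order_trans subsetD)

lemma max_sets_antichain: "S \<subseteq> Pow N \<Longrightarrow> max_sets S \<in> antichains N"
  unfolding antichains_def max_sets_def by (intro CollectI conjI) (blast, simp)

text \<open>Finiteness places every member of \<open>S\<close> below a maximal one, so discarding
  the non-maximal members does not shrink the down-set. Joins and meets can thus be computed on
  down-sets without mentioning \<open>max_sets\<close>.\<close>

lemma down_max_sets:
  assumes "finite S"
  shows "down (max_sets S) = down S"
proof
  show "down (max_sets S) \<subseteq> down S"
    by (auto simp: down_def max_sets_def)
  show "down S \<subseteq> down (max_sets S)"
  proof
    fix X assume "X \<in> down S"
    then obtain B where "B \<in> S" "X \<subseteq> B"
      unfolding down_def by blast
    with assms obtain M where "M \<in> S" "B \<subseteq> M" "\<forall>C\<in>S. M \<subseteq> C \<longrightarrow> M = C"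
      by (meson finite_has_maximal2)
    then have "M \<in> max_sets S" "X \<subseteq> M"
      using \<open>X \<subseteq> B\<close> by (simp_all add: max_sets_def)
    then show "X \<in> down (max_sets S)"
      by (auto simp: down_def)
  qed
qed

text \<open>Antisymmetry of the order on antichains: a chain
  \<open>A \<subseteq> B \<subseteq> C\<close> with \<open>A\<close> and \<open>C\<close> in the
  same antichain collapses to a single set. It reduces each equation between lattice terms below to
  a set identity between down-sets.\<close>

lemma down_inject:
  assumes "\<alpha> \<in> antichains N" "\<beta> \<in> antichains N" "down \<alpha> = down \<beta>"
  shows "\<alpha> = \<beta>"
proof -
  have *: "\<alpha> \<subseteq> \<beta>"
    if ac: "\<alpha> \<in> antichains N" and le: "\<alpha> \<preceq> \<beta>" and ge: "\<beta> \<preceq> \<alpha>" for \<alpha> \<beta> :: "'a set set"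
  proof
    fix A assume A: "A \<in> \<alpha>"
    then obtain B where B: "B \<in> \<beta>" "A \<subseteq> B"
      using le unfolding ac_le_def by blast
    then obtain C where C: "C \<in> \<alpha>" "B \<subseteq> C"
      using ge unfolding ac_le_def by blast
    with A B ac have "A = C"
      unfolding antichains_def by (simp add: subset_trans)
    with B C have "A = B" by simp
    with B show "A \<in> \<beta>" by simp
  qed
  have "\<alpha> \<preceq> \<beta>" "\<beta> \<preceq> \<alpha>"
    using assms(3) by (simp_all add: ac_le_iff_down)
  then show ?thesis
    using *[OF assms(1)] *[OF assms(2)] by blast
qed

lemma ac_join_antichain:
  "\<alpha> \<in> antichains N \<Longrightarrow> \<beta> \<in> antichains N \<Longrightarrow> \<alpha> \<curlyvee> \<beta> \<in> antichains N"
  unfolding ac_join_def by (rule max_sets_antichain) (auto simp: antichains_def)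

lemma ac_meet_antichain:
  "\<alpha> \<in> antichains N \<Longrightarrow> \<beta> \<in> antichains N \<Longrightarrow> \<alpha> \<curlywedge> \<beta> \<in> antichains N"
  unfolding ac_meet_def by (rule max_sets_antichain) (auto simp: antichains_def)

context
  fixes N :: "'a set"
  assumes fin: "finite N"
begin

lemma down_join:
  assumes "\<alpha> \<in> antichains N" "\<beta> \<in> antichains N"
  shows "down (\<alpha> \<curlyvee> \<beta>) = down \<alpha> \<union> down \<beta>"
  using assms fin by (simp add: ac_join_def down_max_sets finite_antichain down_Un)

text \<open>A set lies below some \<open>A\<close> in \<alpha> and some \<open>B\<close> in \<beta>
  exactly when it lies below their intersection; passing to the maximal intersections keeps the
  down-set, as there are only finitely many.\<close>

lemma down_meet:
  assumes "\<alpha> \<in> antichains N" "\<beta> \<in> antichains N"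
  shows "down (\<alpha> \<curlywedge> \<beta>) = down \<alpha> \<inter> down \<beta>"
proof -
  have "finite {A \<inter> B | A B. A \<in> \<alpha> \<and> B \<in> \<beta>}"
    using assms fin by (intro finite_image_set2) (auto simp: finite_antichain)
  then have "down (\<alpha> \<curlywedge> \<beta>) = down {A \<inter> B | A B. A \<in> \<alpha> \<and> B \<in> \<beta>}"
    unfolding ac_meet_def by (rule down_max_sets)
  also have "\<dots> = down \<alpha> \<inter> down \<beta>"
  proof
    show "down {A \<inter> B | A B. A \<in> \<alpha> \<and> B \<in> \<beta>} \<subseteq> down \<alpha> \<inter> down \<beta>"
      by (auto simp: down_def)
    show "down \<alpha> \<inter> down \<beta> \<subseteq> down {A \<inter> B | A B. A \<in> \<alpha> \<and> B \<in> \<beta>}"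
    proof
      fix X assume "X \<in> down \<alpha> \<inter> down \<beta>"
      then obtain A B where "A \<in> \<alpha>" "B \<in> \<beta>" and X: "X \<subseteq> A \<inter> B"
        by (auto simp: down_def)
      then have "A \<inter> B \<in> {A \<inter> B | A B. A \<in> \<alpha> \<and> B \<in> \<beta>}"
        by blast
      with X show "X \<in> down {A \<inter> B | A B. A \<in> \<alpha> \<and> B \<in> \<beta>}"
        unfolding down_def by - (rule CollectI, rule bexI)
    qed
  qed
  finally show ?thesis .
qed

text \<open>The lower bounds \<open>p\<^sub>1\<close> and \<open>p\<^sub>2\<close> are kept separate
  so that one statement covers both decompositions of the theorem: with the common lower bound
  \<alpha>, and with the two lower bounds obtained by meeting \<alpha> with each part of
  \<beta>.\<close>

lemma direct_join_intervals:
  assumes p: "p\<^sub>1 \<in> antichains N" "p\<^sub>2 \<in> antichains N"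
    and q: "q\<^sub>1 \<in> antichains N" "q\<^sub>2 \<in> antichains N"
    and le: "p\<^sub>1 \<preceq> q\<^sub>1" "p\<^sub>2 \<preceq> q\<^sub>2"
    and meet: "q\<^sub>1 \<curlywedge> q\<^sub>2 \<preceq> p\<^sub>1" "q\<^sub>1 \<curlywedge> q\<^sub>2 \<preceq> p\<^sub>2"
  shows "ac_interval N (p\<^sub>1 \<curlyvee> p\<^sub>2) (q\<^sub>1 \<curlyvee> q\<^sub>2) =
           interval_join (ac_interval N p\<^sub>1 q\<^sub>1) (ac_interval N p\<^sub>2 q\<^sub>2)
       \<and> direct_join (ac_interval N p\<^sub>1 q\<^sub>1) (ac_interval N p\<^sub>2 q\<^sub>2)"
    (is "?I = interval_join ?I\<^sub>1 ?I\<^sub>2 \<and> _")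
proof (intro conjI equalityI subsetI)
  note down_simps = ac_interval_def ac_le_iff_down down_join down_meet p q
    ac_join_antichain ac_meet_antichain
  have meet': "down q\<^sub>1 \<inter> down q\<^sub>2 \<subseteq> down p\<^sub>1" "down q\<^sub>1 \<inter> down q\<^sub>2 \<subseteq> down p\<^sub>2"
    using meet by (simp_all add: down_simps)
  have le': "down p\<^sub>1 \<subseteq> down q\<^sub>1" "down p\<^sub>2 \<subseteq> down q\<^sub>2"
    using le by (simp_all add: down_simps)
  show "\<chi> \<in> interval_join ?I\<^sub>1 ?I\<^sub>2" if "\<chi> \<in> ?I" for \<chi>
  proof -
    have \<chi>: "\<chi> \<in> antichains N" "down p\<^sub>1 \<union> down p\<^sub>2 \<subseteq> down \<chi>" "down \<chi> \<subseteq> down q\<^sub>1 \<union> down q\<^sub>2"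
      using that by (simp_all add: down_simps)
    \<comment> \<open>Distributivity: the down-set of \<chi> is contained in the union of those of
      \<open>q\<^sub>1\<close> and \<open>q\<^sub>2\<close>, so it is the union of its traces on the
      two.\<close>
    then have "\<chi> = (\<chi> \<curlywedge> q\<^sub>1) \<curlyvee> (\<chi> \<curlywedge> q\<^sub>2)"
      by - (rule down_inject[of _ N]; auto simp: down_simps)
    moreover have "\<chi> \<curlywedge> q\<^sub>1 \<in> ?I\<^sub>1" "\<chi> \<curlywedge> q\<^sub>2 \<in> ?I\<^sub>2"
      using \<chi> le' by (auto simp: down_simps)
    ultimately show ?thesis
      unfolding interval_join_def by blast
  qed
  show "\<chi> \<in> ?I" if "\<chi> \<in> interval_join ?I\<^sub>1 ?I\<^sub>2" for \<chi>
    using that unfolding interval_join_def by (auto simp: down_simps)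
  \<comment> \<open>On down-sets, intersecting with \<open>q\<^sub>1\<close> leaves
    \<open>\<chi>\<^sub>1\<close> unchanged and cuts \<open>\<chi>\<^sub>2\<close> to a part of
    \<open>q\<^sub>1 \<inter> q\<^sub>2\<close>, which is inside \<open>p\<^sub>1\<close> and hence
    already inside \<open>\<chi>\<^sub>1\<close>. The other index is symmetric.\<close>
  have recover: "(\<chi>\<^sub>1 \<curlyvee> \<chi>\<^sub>2) \<curlywedge> q\<^sub>1 = \<chi>\<^sub>1" "(\<chi>\<^sub>1 \<curlyvee> \<chi>\<^sub>2) \<curlywedge> q\<^sub>2 = \<chi>\<^sub>2"
    if "\<chi>\<^sub>1 \<in> ?I\<^sub>1" "\<chi>\<^sub>2 \<in> ?I\<^sub>2" for \<chi>\<^sub>1 \<chi>\<^sub>2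
  proof -
    have \<chi>: "\<chi>\<^sub>1 \<in> antichains N" "\<chi>\<^sub>2 \<in> antichains N"
        "down p\<^sub>1 \<subseteq> down \<chi>\<^sub>1" "down \<chi>\<^sub>1 \<subseteq> down q\<^sub>1" "down p\<^sub>2 \<subseteq> down \<chi>\<^sub>2" "down \<chi>\<^sub>2 \<subseteq> down q\<^sub>2"
      using that by (simp_all add: down_simps)
    then have "(down \<chi>\<^sub>1 \<union> down \<chi>\<^sub>2) \<inter> down q\<^sub>1 = down \<chi>\<^sub>1"
        "(down \<chi>\<^sub>1 \<union> down \<chi>\<^sub>2) \<inter> down q\<^sub>2 = down \<chi>\<^sub>2"
      using meet' by blast+
    with \<chi>(1,2) show "(\<chi>\<^sub>1 \<curlyvee> \<chi>\<^sub>2) \<curlywedge> q\<^sub>1 = \<chi>\<^sub>1" "(\<chi>\<^sub>1 \<curlyvee> \<chi>\<^sub>2) \<curlywedge> q\<^sub>2 = \<chi>\<^sub>2"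
      by - (rule down_inject[of _ N]; simp add: down_simps)+
  qed
  show "direct_join ?I\<^sub>1 ?I\<^sub>2"
    unfolding direct_join_def
  proof
    fix \<chi> assume "\<chi> \<in> interval_join ?I\<^sub>1 ?I\<^sub>2"
    then obtain \<chi>\<^sub>1 \<chi>\<^sub>2 where \<chi>: "\<chi>\<^sub>1 \<in> ?I\<^sub>1" "\<chi>\<^sub>2 \<in> ?I\<^sub>2" "\<chi> = \<chi>\<^sub>1 \<curlyvee> \<chi>\<^sub>2"
      unfolding interval_join_def by blast
    show "\<exists>!p. p \<in> ?I\<^sub>1 \<times> ?I\<^sub>2 \<and> \<chi> = fst p \<curlyvee> snd p"
    proof (rule ex1I)
      show "(\<chi>\<^sub>1, \<chi>\<^sub>2) \<in> ?I\<^sub>1 \<times> ?I\<^sub>2 \<and> \<chi> = fst (\<chi>\<^sub>1, \<chi>\<^sub>2) \<curlyvee> snd (\<chi>\<^sub>1, \<chi>\<^sub>2)"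
        using \<chi> by simp
      fix p assume p: "p \<in> ?I\<^sub>1 \<times> ?I\<^sub>2 \<and> \<chi> = fst p \<curlyvee> snd p"
      \<comment> \<open>Both components are now expressed through \<chi> alone, which forces any two
        decompositions of \<chi> to agree.\<close>
      then have "fst p = \<chi> \<curlywedge> q\<^sub>1" "snd p = \<chi> \<curlywedge> q\<^sub>2"
        using recover[of "fst p" "snd p"] by (simp_all add: mem_Times_iff)
      then show "p = (\<chi>\<^sub>1, \<chi>\<^sub>2)"
        using recover[OF \<chi>(1,2)] \<chi>(3) by (simp add: prod_eq_iff)
    qed
  qed
qed

end

theorem lemma4p3:
  fixes N :: "'a set" and \<alpha> \<beta> \<nu>\<^sub>1 \<nu>\<^sub>2 :: "'a set set"
  assumes "finite N"
    and "\<alpha> \<in> antichains N" and "\<beta> \<in> antichains N" and "\<alpha> \<preceq> \<beta>"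
    and "\<beta> = \<nu>\<^sub>1 \<union> \<nu>\<^sub>2"
    and "\<forall>A\<in>\<nu>\<^sub>1. \<forall>B\<in>\<nu>\<^sub>2. {A, B} \<notin> interval_graph_edges \<alpha> \<beta>"
  shows "ac_interval N \<alpha> \<beta> =
           interval_join (ac_interval N \<alpha> (\<alpha> \<curlyvee> \<nu>\<^sub>1)) (ac_interval N \<alpha> (\<alpha> \<curlyvee> \<nu>\<^sub>2))
       \<and> direct_join (ac_interval N \<alpha> (\<alpha> \<curlyvee> \<nu>\<^sub>1)) (ac_interval N \<alpha> (\<alpha> \<curlyvee> \<nu>\<^sub>2))
       \<and> ac_interval N \<alpha> \<beta> =
           interval_join (ac_interval N (\<alpha> \<curlywedge> \<nu>\<^sub>1) \<nu>\<^sub>1) (ac_interval N (\<alpha> \<curlywedge> \<nu>\<^sub>2) \<nu>\<^sub>2)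
       \<and> direct_join (ac_interval N (\<alpha> \<curlywedge> \<nu>\<^sub>1) \<nu>\<^sub>1) (ac_interval N (\<alpha> \<curlywedge> \<nu>\<^sub>2) \<nu>\<^sub>2)"
proof -
  note fin = assms(1) and \<alpha> = assms(2) and \<beta> = assms(3)
  have \<nu>: "\<nu>\<^sub>1 \<in> antichains N" "\<nu>\<^sub>2 \<in> antichains N"
    using \<beta> assms(5) by (auto intro: antichains_subset)
  note closed = \<alpha> \<nu> ac_join_antichain ac_meet_antichain
  note down_simps = ac_le_iff_down down_join[OF fin] down_meet[OF fin] closed
  have down_\<beta>: "down \<beta> = down \<nu>\<^sub>1 \<union> down \<nu>\<^sub>2"
    by (simp add: assms(5) down_Un)
  have down_\<alpha>: "down \<alpha> \<subseteq> down \<nu>\<^sub>1 \<union> down \<nu>\<^sub>2"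
    using assms(4) by (simp add: ac_le_iff_down down_\<beta>)
  \<comment> \<open>A common lower set of the two parts lies in some \<open>A \<inter> B\<close>,
    and the missing edge puts \<open>A \<inter> B\<close> below \<alpha>. If the parts overlap, the
    case \<open>A = B\<close> is covered because loops count as edges.\<close>
  have sep: "down \<nu>\<^sub>1 \<inter> down \<nu>\<^sub>2 \<subseteq> down \<alpha>"
  proof
    fix X assume "X \<in> down \<nu>\<^sub>1 \<inter> down \<nu>\<^sub>2"
    then obtain A B where AB: "A \<in> \<nu>\<^sub>1" "B \<in> \<nu>\<^sub>2" and X: "X \<subseteq> A \<inter> B"
      by (auto simp: down_def)
    from AB have "{A \<inter> B} \<preceq> \<alpha>"
      using assms(5,6) unfolding interval_graph_edges_def by blast
    then obtain C where "C \<in> \<alpha>" "A \<inter> B \<subseteq> C"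
      unfolding ac_le_def by blast
    with X show "X \<in> down \<alpha>"
      by (auto simp: down_def)
  qed
  \<comment> \<open>These identify the endpoints of the joined intervals. The second and third
    identities rest on \<alpha> being below \<beta>: joining \<alpha> to \<beta> adds nothing, and
    \<alpha> is the union of its traces on the two parts.\<close>
  have "\<alpha> \<curlyvee> \<alpha> = \<alpha>" "(\<alpha> \<curlyvee> \<nu>\<^sub>1) \<curlyvee> (\<alpha> \<curlyvee> \<nu>\<^sub>2) = \<beta>"
      "(\<alpha> \<curlywedge> \<nu>\<^sub>1) \<curlyvee> (\<alpha> \<curlywedge> \<nu>\<^sub>2) = \<alpha>" "\<nu>\<^sub>1 \<curlyvee> \<nu>\<^sub>2 = \<beta>"
    using \<beta> down_\<alpha>
    by - (rule down_inject[of _ N]; auto simp: down_simps down_\<beta>)+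
  \<comment> \<open>For the third inequality, distributivity turns the meet of the two upper bounds
    into \<open>\<alpha> \<union> (\<nu>\<^sub>1 \<inter> \<nu>\<^sub>2)\<close> on down-sets, which
    \<open>sep\<close> collapses to \<alpha>.\<close>
  moreover have "\<alpha> \<preceq> \<alpha> \<curlyvee> \<nu>\<^sub>1" "\<alpha> \<preceq> \<alpha> \<curlyvee> \<nu>\<^sub>2" "(\<alpha> \<curlyvee> \<nu>\<^sub>1) \<curlywedge> (\<alpha> \<curlyvee> \<nu>\<^sub>2) \<preceq> \<alpha>"
      "\<alpha> \<curlywedge> \<nu>\<^sub>1 \<preceq> \<nu>\<^sub>1" "\<alpha> \<curlywedge> \<nu>\<^sub>2 \<preceq> \<nu>\<^sub>2" "\<nu>\<^sub>1 \<curlywedge> \<nu>\<^sub>2 \<preceq> \<alpha> \<curlywedge> \<nu>\<^sub>1" "\<nu>\<^sub>1 \<curlywedge> \<nu>\<^sub>2 \<preceq> \<alpha> \<curlywedge> \<nu>\<^sub>2"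
    using sep by (auto simp: down_simps)
  ultimately show ?thesis
    using direct_join_intervals[OF fin, of \<alpha> \<alpha> "\<alpha> \<curlyvee> \<nu>\<^sub>1" "\<alpha> \<curlyvee> \<nu>\<^sub>2"]
      direct_join_intervals[OF fin, of "\<alpha> \<curlywedge> \<nu>\<^sub>1" "\<alpha> \<curlywedge> \<nu>\<^sub>2" \<nu>\<^sub>1 \<nu>\<^sub>2]
    by (simp add: closed)
qed

end
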